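(* Let $(X,\preceq)$ be a Riesz space and let $f,g\in\mathcal{F}_{op}(X)$. The following assertions are true: (i) $f^k\in\mathcal{F}_{op}(X)$ for each $k\in\mathbb{N}$. (ii) If $f\trianglelefteq g$, then $f^k\trianglelefteq g^k$ for each $k\in\mathbb{N}$. (iii) If $f$ subcommutes with $g$, then $f$ subcommutes with $g^k$ for each $k\in\mathbb{N}$. (iv) If $f$ subcommutes with $g$ and $x\in X$ satisfies $f(x)\preceq g(x)$, then $f^k(x)\preceq g^k(x)$ for each $k\in\mathbb{N}$.
   Context: A Riesz space is a real vector space $X$ with a partial order $\preceq$ that is a lattice and satisfies: $x\preceq y$ implies $x+z\preceq y+z$ for all $z\in X$; and $0\preceq x$ implies $0\preceq \alpha x$ for all real $\alpha\ge 0$. $\mathcal{F}_{op}(X)$ is the set of all order-preserving self-maps $f:X\to X$ (i.e. $x\preceq y$ implies $f(x)\preceq f(y)$). For self-maps $f,g$ of $X$, $f\trianglelefteq g$ means $f(x)\preceq g(x)$ for all $x\in X$, and $f$ subcommutes with $g$ means $f\circ g\trianglelefteq g\circ f$. $f^k$ denotes the $k$-th iterate of $f$ ($f^0=\mathrm{id}$, $f^k=f\circ f^{k-1}$); $\mathbb{N}=\{1,2,\dots\}$. *)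

theory Defs
  imports Complex_Main
begin

text \<open>The inequality \<open>\<le>\<close> on functions is the pointwise one (\<open>le_fun_def\<close>), i.e. the
  relation \<open>\<unlhd>\<close>; order-preserving self-maps are those satisfying \<open>mono\<close>.\<close>

text \<open>Given translation invariance, the two scaling axioms of \<open>ordered_real_vector\<close> are
  equivalent to: \<open>0 \<le> x\<close> and \<open>0 \<le> a\<close> imply \<open>0 \<le> a *\<^sub>R x\<close>.\<close>

class riesz_space = ordered_real_vector + lattice

definition subcommutes :: "('a::riesz_space \<Rightarrow> 'a) \<Rightarrow> ('a \<Rightarrow> 'a) \<Rightarrow> bool" where
  "subcommutes f g \<longleftrightarrow> f \<circ> g \<le> g \<circ> f"

end

theory Submission
  imports Defs
begin

text \<open>Each claim is an induction on \<open>k\<close>, started at \<open>k = 0\<close>, where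
  iterates are the identity; (i) is \<open>mono_pow\<close>. For (ii), compare the inner iterates
  under the monotone \<open>f\<close>, then replace the outer \<open>f\<close> by \<open>g\<close>.
  For (iii), push \<open>f\<close> inward through the copies of \<open>g\<close>. Claim (iv) rests
  on (iii), via \<open>subcommutes_funpow\<close>.\<close>

lemma funpow_le_funpow:
  fixes f g :: "'a::order \<Rightarrow> 'a"
  assumes "mono f" and "f \<le> g"
  shows "f ^^ k \<le> g ^^ k"
proof (induction k)
  case (Suc k)
  show ?case
  proof (rule le_funI)
    fix x
    have "f ((f ^^ k) x) \<le> f ((g ^^ k) x)"
      by (rule monoD[OF assms(1) le_funD[OF Suc.IH]])
    also have "\<dots> \<le> g ((g ^^ k) x)"
      by (rule le_funD[OF assms(2)])
    finally show "(f ^^ Suc k) x \<le> (g ^^ Suc k) x"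
      by simp
  qed
qed simp

text \<open>\<open>f\<close> passes one copy of \<open>g\<close> by subcommutation; monotonicity of
  \<open>g\<close> then lets the induction hypothesis act beneath that copy.\<close>

lemma subcommutes_funpow:
  assumes "mono g" and "subcommutes f g"
  shows "subcommutes f (g ^^ k)"
proof (induction k)
  case (Suc k)
  show ?case
    unfolding subcommutes_def
  proof (rule le_funI)
    fix x
    have "f (g ((g ^^ k) x)) \<le> g (f ((g ^^ k) x))"
      using assms(2) by (simp add: subcommutes_def le_fun_def)
    also have "\<dots> \<le> g ((g ^^ k) (f x))"
      using Suc.IH by (intro monoD[OF assms(1)]) (simp add: subcommutes_def le_fun_def)
    finally show "(f \<circ> g ^^ Suc k) x \<le> (g ^^ Suc k \<circ> f) x"
      by simp
  qed
qed (simp add: subcommutes_def le_fun_def)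

text \<open>\<open>f\<close> and \<open>g\<close> are compared only at \<open>x\<close>, so the
  argument of (ii) fails: \<open>f\<close> must first be moved through \<open>g ^^ k\<close> until
  it meets \<open>x\<close>.\<close>

lemma subcommutes_funpow_le_funpow:
  assumes "mono f" and "mono g" and "subcommutes f g" and "f x \<le> g x"
  shows "(f ^^ k) x \<le> (g ^^ k) x"
proof (induction k)
  case (Suc k)
  have "f ((f ^^ k) x) \<le> f ((g ^^ k) x)"
    using Suc.IH by (rule monoD[OF assms(1)])
  also have "\<dots> \<le> (g ^^ k) (f x)"
    using subcommutes_funpow[OF assms(2,3)] by (simp add: subcommutes_def le_fun_def)
  also have "\<dots> \<le> (g ^^ k) (g x)"
    using mono_pow[OF assms(2)] assms(4) by (rule monoD)
  finally show ?case
    \<comment> \<open>The new \<open>g\<close> is innermost but the new \<open>f\<close> outermost,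
      so only the iterate of \<open>g\<close> is unfolded from the right.\<close>
    unfolding funpow_Suc_right[of k g] by simp
qed simp

theorem theorem1:
  fixes f g :: "'a::riesz_space \<Rightarrow> 'a"
  assumes "mono f" and "mono g"
  shows "(\<forall>k\<ge>1. mono (f ^^ k))
    \<and> (f \<le> g \<longrightarrow> (\<forall>k\<ge>1. f ^^ k \<le> g ^^ k))
    \<and> (subcommutes f g \<longrightarrow> (\<forall>k\<ge>1. subcommutes f (g ^^ k)))
    \<and> (\<forall>x. subcommutes f g \<and> f x \<le> g x \<longrightarrow> (\<forall>k\<ge>1. (f ^^ k) x \<le> (g ^^ k) x))"
  by (simp add: assms mono_pow funpow_le_funpow subcommutes_funpow subcommutes_funpow_le_funpow)

end
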